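(* For every $\lambda\in(0,1)$, standard (respectively, degree-weighted) Lambda-Louvain either places all nodes in one cluster, or produces clusters $S$ each of which has scaled sparsest cut $\mathrm{cut}(S)/(|S||\bar S|)$ (respectively, scaled normalized cut $\mathrm{cut}(S)/(\mathrm{vol}(S)\mathrm{vol}(\bar S))$) bounded above by $\lambda$. The same holds true for GrowCluster.
   Context: Let $G=(V,E)$ be an undirected, unweighted graph, $d_v$ the degree of $v$, $\mathrm{vol}(S)=\sum_{v\in S}d_v$, $\bar S = V\setminus S$, and for disjoint $S,T$, $\mathrm{cut}(S,T)$ the number of edges between $S$ and $T$, with $\mathrm{cut}(S)=\mathrm{cut}(S,\bar S)$. The LambdaCC objective with node weights $w_v$ and parameter $\lambda$ is to minimize, over clusterings with binary distances $x_{ij}$, $\sum_{(i,j)\in E}(1-\lambda w_iw_j)x_{ij} + \sum_{(i,j)\notin E}\lambda w_iw_j(1-x_{ij})$; "standard" uses $w_v=1$ and "degree-weighted" uses $w_v=d_v$. Lambda-Louvain is the Louvain method (iteratively moving nodes to adjacent clusters when that gives a locally best improvement, then aggregating clusters into super-nodes and repeating) adapted to greedily improve the LambdaCC objective instead of modularity; at termination no merge of two clusters improves the objective. GrowCluster repeatedly picks a uniformly random unclustered node $u$, sets $S=\{u\}$, and greedily adds the unclustered node $v$ maximizing $\Delta_v=\mathrm{cut}(S,\{v\})-\lambda|S|$ (standard) or $\Delta_v=\mathrm{cut}(S,\{v\})-\lambda w_v\mathrm{vol}(S)$ (degree-weighted) while this maximum is positive; then $S$ is output as a cluster and removed, and the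 process repeats until all nodes are clustered. *)

theory Defs
  imports Complex_Main "HOL-Library.Ramsey"
begin

text \<open>Finite simple undirected graphs; \<open>nsets V 2\<close> is the set of two-element subsets of \<open>V\<close>.\<close>

definition simple_graph :: "'a set \<Rightarrow> 'a set set \<Rightarrow> bool" where
  "simple_graph V E \<longleftrightarrow> finite V \<and> E \<subseteq> nsets V 2"

definition deg :: "'a set set \<Rightarrow> 'a \<Rightarrow> nat" where
  "deg E v = card {e \<in> E. v \<in> e}"

definition vol :: "'a set set \<Rightarrow> 'a set \<Rightarrow> nat" where
  "vol E S = (\<Sum>v\<in>S. deg E v)"

definition cut :: "'a set set \<Rightarrow> 'a set \<Rightarrow> 'a set \<Rightarrow> nat" where
  "cut E S T = card {e \<in> E. \<exists>s\<in>S. \<exists>t\<in>T. e = {s, t}}"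

definition scaled_sparsest_cut :: "'a set \<Rightarrow> 'a set set \<Rightarrow> 'a set \<Rightarrow> real" where
  "scaled_sparsest_cut V E S =
     real (cut E S (V - S)) / (real (card S) * real (card (V - S)))"

definition scaled_normalized_cut :: "'a set \<Rightarrow> 'a set set \<Rightarrow> 'a set \<Rightarrow> real" where
  "scaled_normalized_cut V E S =
     real (cut E S (V - S)) / (real (vol E S) * real (vol E (V - S)))"

text \<open>A clustering is the set of its (nonempty) clusters. The binary distance of an unordered pair
  \<open>p = {i, j}\<close> is 0 if some cluster contains both \<open>i\<close> and \<open>j\<close>, and 1 otherwise;
  \<open>\<Prod>v\<in>p. w v\<close> is \<open>w i * w j\<close>.\<close>

definition cluster_dist :: "'a set set \<Rightarrow> 'a set \<Rightarrow> real" where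
  "cluster_dist C p = (if \<exists>A\<in>C. p \<subseteq> A then 0 else 1)"

definition lambda_cc ::
  "'a set \<Rightarrow> 'a set set \<Rightarrow> ('a \<Rightarrow> real) \<Rightarrow> real \<Rightarrow> 'a set set \<Rightarrow> real" where
  "lambda_cc V E w lam C =
     (\<Sum>p\<in>E. (1 - lam * (\<Prod>v\<in>p. w v)) * cluster_dist C p) +
     (\<Sum>p\<in>nsets V 2 - E. lam * (\<Prod>v\<in>p. w v) * (1 - cluster_dist C p))"

text \<open>The Louvain method for minimising an objective \<open>f\<close> on clusterings of the vertices. A super-node
  is represented by the set of original vertices merged into it, so that the clusterings of the
  aggregated graph are the clusterings of the original graph whose clusters are unions of super-nodes,
  with the same objective value. Super-nodes may be visited in any order and ties between best moves
  may be broken arbitrarily; a run is one resolution of these choices.\<close>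

definition move_to :: "'a set \<Rightarrow> 'a set \<Rightarrow> 'a set set \<Rightarrow> 'a set set" where
  "move_to X B C = (\<lambda>D. if D = B then D \<union> X else D - X) ` C - {{}}"

definition adjacent_clusters :: "'a set set \<Rightarrow> 'a set set \<Rightarrow> 'a set \<Rightarrow> 'a set set" where
  "adjacent_clusters E C X = {B \<in> C. \<not> X \<subseteq> B \<and> cut E X B > 0}"

definition local_move ::
  "('a set set \<Rightarrow> real) \<Rightarrow> 'a set set \<Rightarrow> 'a set set \<Rightarrow> 'a set set \<Rightarrow> 'a set set \<Rightarrow> bool" where
  "local_move f E P C C' \<longleftrightarrow>
     (\<exists>X\<in>P. \<exists>B.
        is_arg_min (\<lambda>B. f (move_to X B C)) (\<lambda>B. B \<in> adjacent_clusters E C X) B \<and>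
        f (move_to X B C) < f C \<and>
        C' = move_to X B C)"

definition local_phase ::
  "('a set set \<Rightarrow> real) \<Rightarrow> 'a set set \<Rightarrow> 'a set set \<Rightarrow> 'a set set \<Rightarrow> bool" where
  "local_phase f E P C \<longleftrightarrow>
     (local_move f E P)\<^sup>*\<^sup>* P C \<and> (\<nexists>C'. local_move f E P C C')"

text \<open>\<open>louvain f E P C\<close>: started on the super-nodes \<open>P\<close>, some run outputs \<open>C\<close>.\<close>

inductive louvain ::
  "('a set set \<Rightarrow> real) \<Rightarrow> 'a set set \<Rightarrow> 'a set set \<Rightarrow> 'a set set \<Rightarrow> bool"
  for f E where
  stop: "local_phase f E P P \<Longrightarrow> louvain f E P P"
| aggregate: "local_phase f E P C \<Longrightarrow> C \<noteq> P \<Longrightarrow> louvain f E C D \<Longrightarrow> louvain f E P D"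

definition lambda_louvain ::
  "'a set \<Rightarrow> 'a set set \<Rightarrow> ('a \<Rightarrow> real) \<Rightarrow> real \<Rightarrow> 'a set set \<Rightarrow> bool" where
  "lambda_louvain V E w lam C \<longleftrightarrow> louvain (lambda_cc V E w lam) E ((\<lambda>v. {v}) ` V) C"

definition standard_lambda_louvain :: "'a set \<Rightarrow> 'a set set \<Rightarrow> real \<Rightarrow> 'a set set \<Rightarrow> bool" where
  "standard_lambda_louvain V E = lambda_louvain V E (\<lambda>_. 1)"

definition degree_lambda_louvain :: "'a set \<Rightarrow> 'a set set \<Rightarrow> real \<Rightarrow> 'a set set \<Rightarrow> bool" where
  "degree_lambda_louvain V E = lambda_louvain V E (\<lambda>v. real (deg E v))"

text \<open>GrowCluster for a gain function \<open>\<Delta>\<close>, with unclustered nodes \<open>U\<close>. The start node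
  may be any unclustered node, i.e. any outcome of the uniform random choice, and ties between
  maximisers may be broken arbitrarily.\<close>

inductive partial_cluster :: "('a set \<Rightarrow> 'a \<Rightarrow> real) \<Rightarrow> 'a set \<Rightarrow> 'a set \<Rightarrow> bool"
  for \<Delta> U where
  start: "u \<in> U \<Longrightarrow> partial_cluster \<Delta> U {u}"
| add: "partial_cluster \<Delta> U S \<Longrightarrow> is_arg_max (\<Delta> S) (\<lambda>v. v \<in> U - S) v \<Longrightarrow> \<Delta> S v > 0
    \<Longrightarrow> partial_cluster \<Delta> U (insert v S)"

definition grown_cluster :: "('a set \<Rightarrow> 'a \<Rightarrow> real) \<Rightarrow> 'a set \<Rightarrow> 'a set \<Rightarrow> bool" where
  "grown_cluster \<Delta> U S \<longleftrightarrow> partial_cluster \<Delta> U S \<and> \<not> (\<exists>v\<in>U - S. \<Delta> S v > 0)"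

inductive grow_cluster :: "('a set \<Rightarrow> 'a \<Rightarrow> real) \<Rightarrow> 'a set \<Rightarrow> 'a set set \<Rightarrow> bool"
  for \<Delta> where
  empty: "grow_cluster \<Delta> {} {}"
| emit: "grown_cluster \<Delta> U S \<Longrightarrow> grow_cluster \<Delta> (U - S) C \<Longrightarrow> grow_cluster \<Delta> U (insert S C)"

definition standard_grow_cluster :: "'a set \<Rightarrow> 'a set set \<Rightarrow> real \<Rightarrow> 'a set set \<Rightarrow> bool" where
  "standard_grow_cluster V E lam =
     grow_cluster (\<lambda>S v. real (cut E S {v}) - lam * real (card S)) V"

definition degree_grow_cluster :: "'a set \<Rightarrow> 'a set set \<Rightarrow> real \<Rightarrow> 'a set set \<Rightarrow> bool" where
  "degree_grow_cluster V E lam =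
     grow_cluster (\<lambda>S v. real (cut E S {v}) - lam * real (deg E v) * real (vol E S)) V"

end

theory Submission
  imports Defs "HOL-Library.Disjoint_Sets"
begin

text \<open>Write \<open>w(S)\<close> for the total weight of \<open>S\<close>. Merging two clusters \<open>X\<close> and \<open>B\<close> changes the
  LambdaCC objective by \<open>\<lambda> w(X) w(B) - cut(X, B)\<close>. In an output of Lambda-Louvain no merge of
  adjacent clusters improves the objective, and for non-adjacent clusters the cut is zero, so
  \<open>cut(X, B) \<le> \<lambda> w(X) w(B)\<close> for all pairs of clusters; summing over \<open>B \<noteq> X\<close> gives the bound. For
  GrowCluster, a cluster \<open>S\<close> grown inside \<open>U\<close> satisfies \<open>cut(S, {v}) \<le> \<lambda> w(S) w(v)\<close> for all
  \<open>v \<in> U - S\<close>. Summing over \<open>v\<close> bounds the cut between \<open>S\<close> and each later cluster, and by symmetry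
  also the cut between a later cluster and \<open>S\<close>.\<close>

section \<open>Cuts as sets of crossing pairs\<close>

text \<open>Kept independent of \<open>E\<close>: its edges make up the cut, while the whole set,
  edges and non-edges alike, carries the weight terms of the objective.\<close>

definition crossing_pairs :: "'a set \<Rightarrow> 'a set \<Rightarrow> 'a set set" where
  "crossing_pairs S T = {p. \<exists>s\<in>S. \<exists>t\<in>T. p = {s, t}}"

lemma cut_eq_card_crossing_pairs: "cut E S T = card (E \<inter> crossing_pairs S T)"
  unfolding cut_def crossing_pairs_def by (rule arg_cong[where f = card]) auto

lemma crossing_pairs_commute: "crossing_pairs S T = crossing_pairs T S"
  unfolding crossing_pairs_def by (auto simp: doubleton_eq_iff)

lemma cut_commute: "cut E S T = cut E T S"
  by (simp add: cut_eq_card_crossing_pairs crossing_pairs_commute)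

lemma cut_empty_right [simp]: "cut E S {} = 0"
  by (simp add: cut_def)

text \<open>No pair is counted twice: \<open>{s, t} = {s', t'}\<close> with \<open>t\<close> in
  \<open>T\<close> and \<open>t'\<close> in \<open>T'\<close> would force \<open>t = t'\<close> or
  \<open>t = s'\<close>, and each is excluded by a disjointness assumption.\<close>

lemma cut_Un_right:
  assumes "finite E" "S \<inter> (T \<union> T') = {}" "T \<inter> T' = {}"
  shows "cut E S (T \<union> T') = cut E S T + cut E S T'"
proof -
  have "E \<inter> crossing_pairs S (T \<union> T') = (E \<inter> crossing_pairs S T) \<union> (E \<inter> crossing_pairs S T')"
    unfolding crossing_pairs_def by auto
  moreover have "(E \<inter> crossing_pairs S T) \<inter> (E \<inter> crossing_pairs S T') = {}"
    using assms unfolding crossing_pairs_def by (auto simp: doubleton_eq_iff)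
  ultimately show ?thesis
    using \<open>finite E\<close> by (simp add: cut_eq_card_crossing_pairs card_Un_disjoint)
qed

lemma cut_Union_right:
  assumes "finite A" "finite E" "disjoint A" "S \<inter> \<Union>A = {}"
  shows "cut E S (\<Union>A) = (\<Sum>B\<in>A. cut E S B)"
  using assms
proof (induction A rule: finite_induct)
  case (insert B A)
  have "B \<inter> \<Union>A = {}"
    using insert.hyps insert.prems by (auto simp: disjoint_def)
  moreover have "disjoint A"
    using insert.prems by (simp add: pairwise_insert)
  ultimately show ?case
    using insert by (simp add: cut_Un_right Int_Un_distrib)
qed simp

lemma cut_eq_sum_singletons:
  assumes "finite T" "finite E" "S \<inter> T = {}"
  shows "cut E S T = (\<Sum>v\<in>T. cut E S {v})"
  using assms
proof (induction T rule: finite_induct)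
  case (insert v T)
  then show ?case
    using cut_Un_right[of E S "{v}" T] by simp
qed simp

lemma simple_graph_finite_edges: "simple_graph V E \<Longrightarrow> finite E"
  unfolding simple_graph_def using finite_imp_finite_nsets finite_subset by blast

lemma crossing_pairs_subset_nsets:
  assumes "S \<subseteq> V" "T \<subseteq> V" "S \<inter> T = {}"
  shows "crossing_pairs S T \<subseteq> nsets V 2"
  using assms unfolding crossing_pairs_def nsets_def by (auto simp: card_insert_if)

section \<open>The LambdaCC objective under a merge\<close>

lemma sum_prod_crossing_pairs:
  fixes w :: "'a \<Rightarrow> real"
  assumes "S \<inter> T = {}"
  shows "(\<Sum>p\<in>crossing_pairs S T. \<Prod>v\<in>p. w v) = sum w S * sum w T"
proof -
  have inj: "inj_on (\<lambda>(s, t). {s, t}) (S \<times> T)"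
    using assms by (auto simp: inj_on_def doubleton_eq_iff)
  have "crossing_pairs S T = (\<lambda>(s, t). {s, t}) ` (S \<times> T)"
    unfolding crossing_pairs_def by auto
  then have "(\<Sum>p\<in>crossing_pairs S T. \<Prod>v\<in>p. w v) = (\<Sum>(s, t)\<in>S \<times> T. \<Prod>v\<in>{s, t}. w v)"
    using inj by (simp add: sum.reindex case_prod_unfold)
  also have "\<dots> = (\<Sum>(s, t)\<in>S \<times> T. w s * w t)"
  proof (rule sum.cong[OF refl], clarify)
    fix s t assume "s \<in> S" "t \<in> T"
    then have "s \<noteq> t" using assms by auto
    then show "(\<Prod>v\<in>{s, t}. w v) = w s * w t" by simp
  qed
  finally show ?thesis
    by (simp add: sum_product sum.cartesian_product)
qed

text \<open>An edge of weight product \<open>w\<close> and distance \<open>x\<close> costs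
  \<open>(1 - lam * w) * x = x - lam * w + lam * w * (1 - x)\<close>. So all pairs share one penalty
  for being together, up to a constant independent of \<open>C\<close>.\<close>

lemma lambda_cc_alt:
  assumes "simple_graph V E"
  shows "lambda_cc V E w lam C =
     (\<Sum>p\<in>E. cluster_dist C p) - lam * (\<Sum>p\<in>E. \<Prod>v\<in>p. w v) +
     lam * (\<Sum>p\<in>nsets V 2. (\<Prod>v\<in>p. w v) * (1 - cluster_dist C p))"
proof -
  have "finite (nsets V 2)" "E \<subseteq> nsets V 2"
    using assms by (auto simp: simple_graph_def finite_imp_finite_nsets)
  note split = sum.subset_diff[OF this(2,1)]
  show ?thesis
    unfolding lambda_cc_def split
    by (simp add: sum_distrib_left sum.distrib sum_subtractf algebra_simps)
qed

lemma partition_on_move_to: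
  assumes "partition_on V C" "X \<subseteq> V" "B \<in> C"
  shows "partition_on V (move_to X B C)"
proof (rule partition_onI)
  have "\<Union>(move_to X B C) = \<Union>((\<lambda>D. if D = B then D \<union> X else D - X) ` C)"
    unfolding move_to_def by auto
  also have "\<dots> = \<Union>C \<union> X"
    using \<open>B \<in> C\<close> by (auto split: if_splits)
  finally show "\<Union>(move_to X B C) = V"
    using assms by (auto simp: partition_on_def)
next
  fix p q assume "p \<in> move_to X B C" "q \<in> move_to X B C" "p \<noteq> q"
  then show "disjnt p q"
    using assms(1) unfolding move_to_def partition_on_def disjoint_def disjnt_def
    by (auto split: if_splits)
qed (auto simp: move_to_def)

text \<open>When the moved super-node is itself a cluster, its old cluster becomes empty and is
  dropped, and the clusters disjoint from it stay as they are.\<close>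

lemma move_to_eq_merge:
  assumes "partition_on V C" "X \<in> C" "B \<in> C" "X \<noteq> B"
  shows "move_to X B C = insert (X \<union> B) (C - {X, B})"
proof -
  have other: "D - X = D" if "D \<in> C" "D \<noteq> X" for D
    using assms that by (auto simp: partition_on_def disjoint_def)
  let ?m = "\<lambda>D. if D = B then D \<union> X else D - X"
  define R where "R = C - {X, B}"
  have C: "C = insert X (insert B R)"
    using assms by (auto simp: R_def)
  have "?m ` R = (\<lambda>D. D) ` R"
    by (rule image_cong) (auto simp: other R_def)
  then have "?m ` C = {{}, X \<union> B} \<union> R"
    using assms(4) unfolding C image_insert by auto
  moreover have "{} \<notin> R" "X \<union> B \<noteq> {}"
    using assms by (auto simp: R_def partition_on_def)
  ultimately show ?thesis
    unfolding move_to_def R_def by auto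
qed

lemma cluster_dist_merge:
  assumes "partition_on V C" "X \<in> C" "B \<in> C" "X \<noteq> B" "p \<in> nsets V 2"
  shows "cluster_dist (insert (X \<union> B) (C - {X, B})) p =
    cluster_dist C p - (if p \<in> crossing_pairs X B then 1 else 0)"
proof -
  obtain i j where p: "p = {i, j}"
    using assms(5) by (auto simp: nsets_def card_2_iff)
  have uniq: "D = D'" if "D \<in> C" "D' \<in> C" "x \<in> D" "x \<in> D'" for D D' x
    using assms(1) that by (auto simp: partition_on_def disjoint_def)
  show ?thesis
  proof (cases "p \<in> crossing_pairs X B")
    case True
    then obtain x b where xb: "x \<in> X" "b \<in> B" "p = {x, b}"
      by (auto simp: crossing_pairs_def)
    \<comment> \<open>A cluster containing both ends would have to equal both \<open>X\<close> and
      \<open>B\<close>.\<close>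
    have "\<not> (\<exists>A\<in>C. p \<subseteq> A)"
      using uniq xb assms by (metis insert_subset)
    with True xb show ?thesis by (auto simp: cluster_dist_def)
  next
    case False
    \<comment> \<open>The merged cluster contains no new pairs except the crossing ones.\<close>
    have "p \<subseteq> X \<or> p \<subseteq> B" if "p \<subseteq> X \<union> B"
      using that False unfolding p crossing_pairs_def by (auto simp: doubleton_eq_iff)
    then have "(\<exists>A\<in>insert (X \<union> B) (C - {X, B}). p \<subseteq> A) \<longleftrightarrow> (\<exists>A\<in>C. p \<subseteq> A)"
      using assms(2,3) by (auto intro: le_supI1 le_supI2)
    with False show ?thesis by (simp add: cluster_dist_def)
  qed
qed

text \<open>Exactly the crossing pairs drop from distance 1 to 0. In the form of
  \<open>lambda_cc_alt\<close>, the edge sum loses the cut, the constant stays, and the sum over all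
  pairs gains the weight products of the crossing pairs.\<close>

lemma lambda_cc_merge:
  assumes G: "simple_graph V E" and C: "partition_on V C" "X \<in> C" "B \<in> C" "X \<noteq> B"
  shows "lambda_cc V E w lam (insert (X \<union> B) (C - {X, B})) =
    lambda_cc V E w lam C - real (cut E X B) + lam * (sum w X * sum w B)"
proof -
  let ?C' = "insert (X \<union> B) (C - {X, B})" and ?K = "crossing_pairs X B"
  have E: "E \<subseteq> nsets V 2" "finite E" and N: "finite (nsets V 2)"
    using G simple_graph_finite_edges by (auto simp: simple_graph_def finite_imp_finite_nsets)
  have disj: "X \<inter> B = {}" and sub: "X \<subseteq> V" "B \<subseteq> V"
    using C by (auto simp: partition_on_def disjoint_def)
  note K = crossing_pairs_subset_nsets[OF sub disj]
  have "(\<Sum>p\<in>E. cluster_dist ?C' p) =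
      (\<Sum>p\<in>E. cluster_dist C p - (if p \<in> ?K then 1 else 0))"
    using E cluster_dist_merge[OF C] by (intro sum.cong) auto
  also have "\<dots> = (\<Sum>p\<in>E. cluster_dist C p) - real (cut E X B)"
    using E by (simp add: sum_subtractf cut_eq_card_crossing_pairs flip: sum.inter_restrict)
  finally have edges: "(\<Sum>p\<in>E. cluster_dist ?C' p) =
      (\<Sum>p\<in>E. cluster_dist C p) - real (cut E X B)" .
  have "(\<Sum>p\<in>nsets V 2. (\<Prod>v\<in>p. w v) * (1 - cluster_dist ?C' p)) =
      (\<Sum>p\<in>nsets V 2. (\<Prod>v\<in>p. w v) * (1 - cluster_dist C p) +
        (if p \<in> ?K then \<Prod>v\<in>p. w v else 0))"
    by (intro sum.cong) (simp_all add: cluster_dist_merge[OF C] algebra_simps)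
  also have "\<dots> = (\<Sum>p\<in>nsets V 2. (\<Prod>v\<in>p. w v) * (1 - cluster_dist C p)) +
      (\<Sum>p\<in>nsets V 2 \<inter> ?K. \<Prod>v\<in>p. w v)"
    using N by (simp add: sum.distrib sum.inter_restrict)
  also have "nsets V 2 \<inter> ?K = ?K"
    using K by auto
  finally have pairs: "(\<Sum>p\<in>nsets V 2. (\<Prod>v\<in>p. w v) * (1 - cluster_dist ?C' p)) =
      (\<Sum>p\<in>nsets V 2. (\<Prod>v\<in>p. w v) * (1 - cluster_dist C p)) + sum w X * sum w B"
    using disj by (simp add: sum_prod_crossing_pairs)
  show ?thesis
    unfolding lambda_cc_alt[OF G] edges pairs by (simp add: algebra_simps)
qed

section \<open>Lambda-Louvain\<close>

lemma partition_on_local_phase: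
  assumes "partition_on V P" "local_phase f E P C"
  shows "partition_on V C"
proof -
  have "(local_move f E P)\<^sup>*\<^sup>* P C"
    using assms(2) by (simp add: local_phase_def)
  then show ?thesis
  proof (induction rule: rtranclp_induct)
    case (step C C')
    then obtain X B where "X \<in> P" "B \<in> C" "C' = move_to X B C"
      by (auto simp: local_move_def is_arg_min_def adjacent_clusters_def)
    moreover have "X \<subseteq> V"
      using \<open>X \<in> P\<close> assms(1) by (auto simp: partition_on_def)
    ultimately show ?case
      using step.IH partition_on_move_to by blast
  qed (rule assms(1))
qed

text \<open>A run can only end by \<open>stop\<close>, so its output is a partition serving as its
  own set of super-nodes, with no improving local move of a whole cluster left.\<close>

lemma louvain_output:
  assumes "louvain f E P D" "partition_on V P"
  shows "partition_on V D \<and> local_phase f E D D"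
  using assms by (induction rule: louvain.induct) (auto dest: partition_on_local_phase)

lemma local_phase_pairwise_cut_le:
  assumes G: "simple_graph V E" and w: "\<And>v. 0 \<le> w v" and lam: "0 \<le> lam"
    and C: "partition_on V C" "X \<in> C" "B \<in> C" "X \<noteq> B"
    and opt: "local_phase (lambda_cc V E w lam) E C C"
  shows "real (cut E X B) \<le> lam * (sum w X * sum w B)"
proof (cases "cut E X B = 0")
  case True
  then show ?thesis
    using w lam by (simp add: sum_nonneg)
next
  case False
  let ?f = "lambda_cc V E w lam" and ?adj = "adjacent_clusters E C X"
  have "finite C"
    using C(1) G finite_elements by (auto simp: simple_graph_def)
  then have fin: "finite ?adj"
    by (simp add: adjacent_clusters_def)
  have "X \<noteq> {}" "X \<inter> B = {}"
    using C by (auto simp: partition_on_def disjoint_def)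
  then have "\<not> X \<subseteq> B"
    by auto
  then have B: "B \<in> ?adj"
    using C False by (simp add: adjacent_clusters_def)
  \<comment> \<open>Only best moves are ever made, and \<open>B\<close> need not be a best target.
    If the best target \<open>B'\<close> gives no improvement, neither does
    \<open>B\<close>.\<close>
  obtain B' where arg_min: "is_arg_min (\<lambda>B. ?f (move_to X B C)) (\<lambda>B. B \<in> ?adj) B'"
    using ex_is_arg_min_if_finite[OF fin] B by blast
  have "?f C \<le> ?f (move_to X B' C)"
  proof (rule ccontr)
    assume "\<not> ?thesis"
    then have "local_move ?f E C C (move_to X B' C)"
      unfolding local_move_def using arg_min \<open>X \<in> C\<close> by (intro bexI[of _ X] exI[of _ B']) auto
    then show False
      using opt by (auto simp: local_phase_def)
  qed
  also have "\<dots> \<le> ?f (move_to X B C)"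
    using arg_min B by (auto simp: is_arg_min_linorder)
  finally show ?thesis
    using lambda_cc_merge[OF G C] move_to_eq_merge[OF C] by simp
qed

lemma lambda_louvain_cut_le:
  assumes G: "simple_graph V E" and w: "\<And>v. 0 \<le> w v" and lam: "0 \<le> lam"
    and run: "lambda_louvain V E w lam C" and S: "S \<in> C"
  shows "real (cut E S (V - S)) \<le> lam * (sum w S * sum w (V - S))"
proof -
  have "partition_on V ((\<lambda>v. {v}) ` V)"
    by (auto simp: partition_on_def disjoint_def)
  then have C: "partition_on V C" and opt: "local_phase (lambda_cc V E w lam) E C C"
    using run louvain_output unfolding lambda_louvain_def by blast+
  have "finite V"
    using G by (simp add: simple_graph_def)
  then have fin: "finite (C - {S})"
    using C finite_elements by auto
  have disj: "disjoint (C - {S})"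
    using C by (auto simp: partition_on_def disjoint_def)
  have rest: "V - S = \<Union>(C - {S})"
    using C S by (auto simp: partition_on_def disjoint_def)
  have "\<forall>B\<in>C - {S}. finite B"
    using C \<open>finite V\<close> by (auto simp: partition_on_def intro: finite_subset)
  then have w_rest: "sum w (V - S) = (\<Sum>B\<in>C - {S}. sum w B)"
    using sum.Union_disjoint[of "C - {S}" w] disj rest by (auto simp: disjoint_def)
  have "S \<inter> \<Union>(C - {S}) = {}"
    using rest by auto
  then have "real (cut E S (V - S)) = (\<Sum>B\<in>C - {S}. real (cut E S B))"
    using cut_Union_right[OF fin simple_graph_finite_edges[OF G] disj, of S] rest by simp
  also have "\<dots> \<le> (\<Sum>B\<in>C - {S}. lam * (sum w S * sum w B))"
    using local_phase_pairwise_cut_le[OF G w lam C S _ _ opt] by (intro sum_mono) auto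
  also have "\<dots> = lam * (sum w S * sum w (V - S))"
    by (simp add: w_rest sum_distrib_left)
  finally show ?thesis .
qed

section \<open>GrowCluster\<close>

lemma partial_cluster_subset: "partial_cluster \<Delta> U S \<Longrightarrow> S \<subseteq> U"
  by (induction rule: partial_cluster.induct) (auto simp: is_arg_max_def)

text \<open>Growth stops when no remaining gain is positive, and these inequalities add up over
  \<open>T\<close>. Allowing any \<open>T\<close> covers both the whole remainder and a single later
  cluster.\<close>

lemma grown_cluster_cut_le:
  assumes fin: "finite U" "finite E" and T: "T \<subseteq> U - S"
    and grown: "grown_cluster (\<lambda>S v. real (cut E S {v}) - lam * w v * sum w S) U S"
  shows "real (cut E S T) \<le> lam * (sum w S * sum w T)"
proof -
  have "finite T"
    using fin T finite_subset by blast
  moreover have "S \<inter> T = {}"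
    using T by auto
  ultimately have "real (cut E S T) = (\<Sum>v\<in>T. real (cut E S {v}))"
    using fin cut_eq_sum_singletons[of T E S] by simp
  also have "\<dots> \<le> (\<Sum>v\<in>T. lam * w v * sum w S)"
    using grown T unfolding grown_cluster_def by (intro sum_mono) force
  also have "\<dots> = lam * (sum w S * sum w T)"
    by (simp add: sum_distrib_left sum_distrib_right mult_ac)
  finally show ?thesis .
qed

text \<open>Induction on the run, with complements taken in the current unclustered set
  \<open>U\<close>. The first emitted cluster is bounded by its own stopping condition; for a later
  one only its cut with the first must be added to the induction hypothesis.\<close>

lemma grow_cluster_cut_le:
  assumes "grow_cluster (\<lambda>S v. real (cut E S {v}) - lam * w v * sum w S) U C"
    and "finite U" "finite E" "S \<in> C"
  shows "S \<subseteq> U \<and> real (cut E S (U - S)) \<le> lam * (sum w S * sum w (U - S))"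
  using assms
proof (induction arbitrary: S rule: grow_cluster.induct)
  case (emit U T C)
  have T: "T \<subseteq> U"
    using emit.hyps partial_cluster_subset by (auto simp: grown_cluster_def)
  note T_cut = grown_cluster_cut_le[OF \<open>finite U\<close> \<open>finite E\<close> _ emit.hyps(1)]
  show ?case
  proof (cases "S = T")
    case True
    then show ?thesis
      using T T_cut by blast
  next
    case False
    then have S: "S \<subseteq> U - T"
      and S_cut: "real (cut E S (U - T - S)) \<le> lam * (sum w S * sum w (U - T - S))"
      using emit by auto
    have U: "U - S = (U - T - S) \<union> T"
      using S T by auto
    have "finite T"
      using T \<open>finite U\<close> finite_subset by blast
    then have w_U: "sum w (U - S) = sum w (U - T - S) + sum w T"
      unfolding U using \<open>finite U\<close> by (subst sum.union_disjoint) auto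
    \<comment> \<open>The edges from \<open>S\<close> back to \<open>T\<close> are counted from the
      side of \<open>T\<close>, whose stopping condition bounds them.\<close>
    have "cut E S (U - S) = cut E S (U - T - S) + cut E T S"
      unfolding U cut_commute[of E T] using S \<open>finite E\<close> by (subst cut_Un_right) auto
    then have "real (cut E S (U - S)) \<le>
        lam * (sum w S * sum w (U - T - S)) + lam * (sum w T * sum w S)"
      using S_cut T_cut[OF S] by simp
    with S show ?thesis
      by (auto simp: w_U algebra_simps)
  qed
qed simp

section \<open>From cut bounds to ratios\<close>

text \<open>A zero denominator, as for \<open>S = V\<close> or a side of zero volume, gives quotient
  0, which \<open>0 \<le> lam\<close> covers.\<close>

lemma divide_le_of_le_mult:
  fixes a b lam :: real
  assumes "a \<le> lam * b" "0 \<le> b" "0 \<le> lam"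
  shows "a / b \<le> lam"
  using assms by (cases "b = 0") (auto simp: divide_simps)

theorem theorem9:
  fixes V :: "'a set" and E :: "'a set set" and lam :: real
  assumes "simple_graph V E" and "0 < lam" and "lam < 1"
  shows "(\<forall>C. standard_lambda_louvain V E lam C \<longrightarrow>
            C = {V} \<or> (\<forall>S\<in>C. scaled_sparsest_cut V E S \<le> lam)) \<and>
         (\<forall>C. degree_lambda_louvain V E lam C \<longrightarrow>
            C = {V} \<or> (\<forall>S\<in>C. scaled_normalized_cut V E S \<le> lam)) \<and>
         (\<forall>C. standard_grow_cluster V E lam C \<longrightarrow>
            C = {V} \<or> (\<forall>S\<in>C. scaled_sparsest_cut V E S \<le> lam)) \<and>
         (\<forall>C. degree_grow_cluster V E lam C \<longrightarrow>
            C = {V} \<or> (\<forall>S\<in>C. scaled_normalized_cut V E S \<le> lam))"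
proof -
  have fin: "finite V" "finite E"
    using assms(1) simple_graph_finite_edges by (auto simp: simple_graph_def)
  have vol: "real (vol E S) = (\<Sum>v\<in>S. real (deg E v))" for S
    by (simp add: vol_def)
  have sparsest: "scaled_sparsest_cut V E S \<le> lam"
    if "real (cut E S (V - S)) \<le> lam * ((\<Sum>v\<in>S. 1) * (\<Sum>v\<in>V - S. 1))" for S
    using that assms(2) unfolding scaled_sparsest_cut_def
    by (intro divide_le_of_le_mult) auto
  have normalized: "scaled_normalized_cut V E S \<le> lam"
    if "real (cut E S (V - S)) \<le>
      lam * ((\<Sum>v\<in>S. real (deg E v)) * (\<Sum>v\<in>V - S. real (deg E v)))" for S
    using that assms(2) unfolding scaled_normalized_cut_def
    by (intro divide_le_of_le_mult) (auto simp: vol sum_nonneg)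
  \<comment> \<open>In all four cases the second alternative is the one established, also for
    \<open>C = {V}\<close>.\<close>
  have "scaled_sparsest_cut V E S \<le> lam"
    if "standard_lambda_louvain V E lam C" "S \<in> C" for C S
    using that assms unfolding standard_lambda_louvain_def
    by (intro sparsest lambda_louvain_cut_le) auto
  moreover have "scaled_normalized_cut V E S \<le> lam"
    if "degree_lambda_louvain V E lam C" "S \<in> C" for C S
    using that assms unfolding degree_lambda_louvain_def
    by (intro normalized lambda_louvain_cut_le) auto
  \<comment> \<open>Unit weights turn \<open>sum w S\<close> into \<open>card S\<close>, and degree
    weights turn it into \<open>vol E S\<close>, so both gain functions are instances of the
    weighted one.\<close>
  moreover have "scaled_sparsest_cut V E S \<le> lam"
    if "standard_grow_cluster V E lam C" "S \<in> C" for C S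
    using that fin grow_cluster_cut_le[of E lam "\<lambda>_. 1" V C S]
    unfolding standard_grow_cluster_def by (intro sparsest) simp
  moreover have "scaled_normalized_cut V E S \<le> lam"
    if "degree_grow_cluster V E lam C" "S \<in> C" for C S
    using that fin grow_cluster_cut_le[of E lam "\<lambda>v. real (deg E v)" V C S]
    unfolding degree_grow_cluster_def vol by (intro normalized) simp
  ultimately show ?thesis
    by blast
qed

end
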